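(* Let $\mu\in\mathbb{R}$, $\sigma>0$, $p\in(0,1)$ and $\alpha\in\mathbb{R}\setminus\{0\}$. Write $y^{\ast}=(y-\mu)/\sigma$, $p_{\alpha_{+}}=p-I(\alpha>0)$ and $p_{\alpha_{-}}=p-I(\alpha<0)$. Suppose $Y$ is a real random variable with probability density function $$ \begin{aligned} f(y)=\frac{2p(1-p)}{\sigma}\Bigg(&\bigg[\Phi\Big(\frac{y^{\ast}}{\alpha}-\alpha p_{\alpha_{-}}\Big)-\Phi\big(-\alpha p_{\alpha_{-}}\big)\bigg]\exp\Big\{-y^{\ast}p_{\alpha_{-}}+\tfrac12\big(\alpha p_{\alpha_{-}}\big)^2\Big\}\,I\Big(\frac{y^{\ast}}{\alpha}>0\Big)\\ &+\Phi\Big(\alpha p_{\alpha_{+}}-\frac{y^{\ast}}{\alpha}I\Big(\frac{y^{\ast}}{\alpha}>0\Big)\Big)\exp\Big\{-y^{\ast}p_{\alpha_{+}}+\tfrac12\big(\alpha p_{\alpha_{+}}\big)^2\Big\}\Bigg),\qquad y\in\mathbb{R}. \end{aligned} $$ Then $Y$ has the hierarchical (mixture) representation $$Y=\mu+\alpha\sigma S+\sigma A(p)W+\sigma\,[B(p)W]^{1/2}U$$ (equality in distribution), where $W$, $S$, $U$ are mutually independent, $W\sim\mathcal{E}(1)$, $S\sim N^{+}(0,1)$, $U\sim N(0,1)$, $A(p)=\frac{1-2p}{p(1-p)}$ and $B(p)=\frac{2}{p(1-p)}$.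
   Context: $\Phi$ denotes the standard normal cumulative distribution function and $I(\cdot)$ the indicator function. $\mathcal{E}(1)$ is the exponential distribution with mean $1$; $N^{+}(0,1)$ is the half-normal distribution, with density $\frac{2}{\sqrt{2\pi}}e^{-s^2/2}$ on $(0,\infty)$; $N(0,1)$ is the standard normal distribution. The distribution with the density $f$ in the claim is called the generalized asymmetric Laplace distribution $GAL(\mu,\sigma,p,\alpha)$. *)

theory Defs
  imports "HOL-Probability.Probability"
begin

definition std_normal_cdf :: "real \<Rightarrow> real" where
  "std_normal_cdf = cdf std_normal_distribution"

definition half_normal_density :: "real \<Rightarrow> real" where
  "half_normal_density s = (if s > 0 then 2 / sqrt (2 * pi) * exp (- s\<^sup>2 / 2) else 0)"

definition p_alpha_plus :: "real \<Rightarrow> real \<Rightarrow> real" where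
  "p_alpha_plus p \<alpha> = p - of_bool (\<alpha> > 0)"

definition p_alpha_minus :: "real \<Rightarrow> real \<Rightarrow> real" where
  "p_alpha_minus p \<alpha> = p - of_bool (\<alpha> < 0)"

definition gal_density :: "real \<Rightarrow> real \<Rightarrow> real \<Rightarrow> real \<Rightarrow> real \<Rightarrow> real" where
  "gal_density \<mu> \<sigma> p \<alpha> y =
    (let ys = (y - \<mu>) / \<sigma>; pp = p_alpha_plus p \<alpha>; pm = p_alpha_minus p \<alpha> in
      2 * p * (1 - p) / \<sigma> *
        ((std_normal_cdf (ys / \<alpha> - \<alpha> * pm) - std_normal_cdf (- \<alpha> * pm))
            * exp (- ys * pm + 1 / 2 * (\<alpha> * pm)\<^sup>2) * of_bool (ys / \<alpha> > 0)
         + std_normal_cdf (\<alpha> * pp - ys / \<alpha> * of_bool (ys / \<alpha> > 0))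
            * exp (- ys * pp + 1 / 2 * (\<alpha> * pp)\<^sup>2)))"

definition gal_A :: "real \<Rightarrow> real" where
  "gal_A p = (1 - 2 * p) / (p * (1 - p))"

definition gal_B :: "real \<Rightarrow> real" where
  "gal_B p = 2 / (p * (1 - p))"

definition gal_latent ::
  "'b measure \<Rightarrow> ('b \<Rightarrow> real) \<Rightarrow> ('b \<Rightarrow> real) \<Rightarrow> ('b \<Rightarrow> real) \<Rightarrow> bool" where
  "gal_latent N W S U \<longleftrightarrow>
     prob_space N \<and>
     prob_space.indep_vars N (\<lambda>_. borel) (\<lambda>i. [W, S, U] ! i) {..<3} \<and>
     distributed N lborel W (exponential_density 1) \<and>
     distributed N lborel S half_normal_density \<and>
     distributed N lborel U std_normal_density"

text \<open>The square root is taken of \<open>B(p) W\<close>, which is nonnegative almost surely; the values that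
  \<^const>\<open>sqrt\<close> takes on the null event \<open>W < 0\<close> do not affect the distribution.\<close>

definition gal_mixture ::
  "real \<Rightarrow> real \<Rightarrow> real \<Rightarrow> real \<Rightarrow> ('b \<Rightarrow> real) \<Rightarrow> ('b \<Rightarrow> real) \<Rightarrow> ('b \<Rightarrow> real) \<Rightarrow> 'b \<Rightarrow> real" where
  "gal_mixture \<mu> \<sigma> p \<alpha> W S U \<omega> =
     \<mu> + \<alpha> * \<sigma> * S \<omega> + \<sigma> * gal_A p * W \<omega> + \<sigma> * sqrt (gal_B p * W \<omega>) * U \<omega>"

end

theory Submission
  imports Defs
begin

text \<open>Conditionally on \<open>W\<close>, the variable \<open>E = A(p) W + sqrt (B(p) W) U\<close> is normal, so its characteristic
  function is the Laplace transform of the exponential distribution at \<open>t\<^sup>2 B(p) / 2 - i t A(p)\<close>.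
  This equals \<open>p (1 - p) / ((p - i t) (1 - p + i t))\<close>, the characteristic function of the asymmetric
  Laplace distribution, whence \<open>E\<close> is asymmetric Laplace by Levy's uniqueness theorem. In the
  convolution with the density of \<open>\<alpha> S\<close>, the exponent of the Laplace factor changes slope at
  \<open>s = x / \<alpha>\<close>; completing the square on each side gives the two normal probabilities in the
  claimed density.\<close>

section \<open>The asymmetric Laplace law and its characteristic function\<close>

text \<open>The exponent is minus the check function of quantile regression: for
  \<open>0 < p < 1\<close> the negative half-line has mass \<open>p\<close>, so 0 is the
  \<open>p\<close>-quantile.\<close>

definition asymmetric_laplace_density :: "real \<Rightarrow> real \<Rightarrow> real" where
  "asymmetric_laplace_density p x = p * (1 - p) * exp (- x * (p - of_bool (x < 0)))"

lemma borel_measurable_asymmetric_laplace_density [measurable]: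
  "asymmetric_laplace_density p \<in> borel_measurable borel"
  unfolding asymmetric_laplace_density_def of_bool_def by measurable

lemma asymmetric_laplace_density_nonneg:
  "0 \<le> p \<Longrightarrow> p \<le> 1 \<Longrightarrow> 0 \<le> asymmetric_laplace_density p x"
  by (simp add: asymmetric_laplace_density_def)

text \<open>The modulus of the integrand is a multiple of an exponential density, which gives
  integrability; the antiderivative \<open>- exp (- c * x) / c\<close> gives the value. It serves
  twice: for the Fourier integral of the asymmetric Laplace density and for averaging over
  \<open>W\<close>.\<close>

lemma has_bochner_integral_exp_Ioi:
  fixes c :: complex
  assumes "0 < Re c"
  shows "has_bochner_integral lborel (\<lambda>x. indicator {0<..} x *\<^sub>R exp (- c * of_real x)) (1 / c)"
proof -
  have c0: "c \<noteq> 0"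
    using assms by auto
  interpret prob_space "density lborel (exponential_density (Re c))"
    by (rule prob_space_exponential_density) fact
  have "integrable (density lborel (exponential_density (Re c))) (\<lambda>_. 1::real)"
    by simp
  then have "integrable lborel (exponential_density (Re c))"
    by (subst (asm) integrable_density) (use assms in \<open>auto intro!: exponential_density_nonneg\<close>)
  \<comment> \<open>Dividing by the rate leaves \<open>exp (- Re c * x)\<close> on the nonnegative
    half-line, the dominating function.\<close>
  then have int: "integrable lborel (\<lambda>x. exponential_density (Re c) x / Re c)"
    by simp
  have I: "integrable lborel (\<lambda>x. indicator {0<..} x *\<^sub>R exp (- c * of_real x))"
    by (rule Bochner_Integration.integrable_bound[OF int])
       (use assms in \<open>auto simp: exponential_density_def indicator_def mult.commute intro!: AE_I2\<close>)
  \<comment> \<open>Passing to norms removes the oscillating factor and leaves a real exponential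
    decay.\<close>
  have lim: "((\<lambda>x. - exp (- c * of_real x) / c) \<longlongrightarrow> 0) at_top"
  proof (rule tendsto_norm_zero_cancel)
    have "((\<lambda>x. exp (- (Re c * x)) / cmod c) \<longlongrightarrow> 0 / cmod c) at_top"
      by (intro tendsto_divide tendsto_const filterlim_compose[OF exp_at_bot]
                filterlim_compose[OF filterlim_uminus_at_bot_at_top]
                filterlim_tendsto_pos_mult_at_top[OF tendsto_const assms] filterlim_ident)
         (use c0 in auto)
    then show "((\<lambda>x. norm (- exp (- c * of_real x) / c)) \<longlongrightarrow> 0) at_top"
      by (simp add: norm_divide)
  qed
  have "(LBINT x=0..\<infinity>. exp (- c * of_real x)) = 0 - (- exp (- c * of_real 0) / c)"
  proof (rule interval_integral_FTC_integrable)
    fix x :: real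
    show "((\<lambda>x. - exp (- c * of_real x) / c) has_vector_derivative exp (- c * of_real x)) (at x)"
      unfolding has_real_derivative_iff_has_vector_derivative[symmetric]
      by (rule has_vector_derivative_real_field) (use c0 in \<open>auto intro!: derivative_eq_intros\<close>)
    show "isCont (\<lambda>x. exp (- c * of_real x)) x"
      by (intro continuous_intros)
  next
    show "set_integrable lborel (einterval 0 \<infinity>) (\<lambda>x. exp (- c * of_real x))"
      using I by (simp add: set_integrable_def einterval_def greaterThan_def zero_ereal_def)
    have "isCont (\<lambda>x::real. - exp (- c * of_real x) / c) 0"
      by (intro continuous_intros c0)
    then have "((\<lambda>x::real. - exp (- c * of_real x) / c) \<longlongrightarrow> - exp (- c * of_real 0) / c) (at_right 0)"
      unfolding isCont_def by (rule filterlim_mono) (auto simp: at_within_le_at)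
    then show "(((\<lambda>x::real. - exp (- c * of_real x) / c) \<circ> real_of_ereal) \<longlongrightarrow> - exp (- c * of_real 0) / c) (at_right 0)"
      by (simp add: ereal_tendsto_simps zero_ereal_def del: ereal_eq_0)
    show "(((\<lambda>x. - exp (- c * of_real x) / c) \<circ> real_of_ereal) \<longlongrightarrow> 0) (at_left \<infinity>)"
      using lim by (simp add: ereal_tendsto_simps)
  qed simp
  then have "integral\<^sup>L lborel (\<lambda>x. indicator {0<..} x *\<^sub>R exp (- c * of_real x)) = 1 / c"
    by (simp add: interval_lebesgue_integral_0_infty set_lebesgue_integral_def)
  with I show ?thesis
    by (simp add: has_bochner_integral_iff)
qed

text \<open>Splitting at 0 gives two exponential integrals, with rate \<open>p - \<i> * t\<close> on
  the right and, after reflection, \<open>1 - p + \<i> * t\<close> on the left. The rates sum to 1,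
  so the sum of their reciprocals is the reciprocal of their product.\<close>

lemma asymmetric_laplace_fourier:
  fixes t p :: real
  assumes p: "0 < p" "p < 1"
  shows "has_bochner_integral lborel (\<lambda>x. asymmetric_laplace_density p x *\<^sub>R iexp (t * x))
           (of_real (p * (1 - p)) / ((of_real p - \<i> * of_real t) * (of_real (1 - p) + \<i> * of_real t)))"
proof -
  let ?c = "of_real p - \<i> * of_real t" and ?d = "of_real (1 - p) + \<i> * of_real t"
  let ?f = "\<lambda>c x::real. indicator {0<..} x *\<^sub>R exp (- c * of_real x) :: complex"
  have re: "0 < Re ?c" "0 < Re ?d"
    using p by auto
  then have nz: "?c \<noteq> 0" "?d \<noteq> 0"
    by (metis less_irrefl zero_complex.simps(1))+
  have 1: "has_bochner_integral lborel (?f ?c) (1 / ?c)"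
    by (intro has_bochner_integral_exp_Ioi re)
  \<comment> \<open>The reflection is written \<open>0 + (-1) * x\<close> to be an instance of
    affine substitution; its Jacobian is 1.\<close>
  have 2: "has_bochner_integral lborel (\<lambda>x. ?f ?d (0 + (-1) * x)) ((1 / ?d) /\<^sub>R \<bar>-1\<bar>)"
    by (intro lborel_has_bochner_integral_real_affine_iff[THEN iffD1] has_bochner_integral_exp_Ioi re) auto
  have 3: "has_bochner_integral lborel (\<lambda>x. of_real (p * (1 - p)) * (?f ?c x + ?f ?d (0 + (-1) * x)))
             (of_real (p * (1 - p)) * (1 / ?c + (1 / ?d) /\<^sub>R \<bar>-1\<bar>))"
    by (intro has_bochner_integral_mult_right has_bochner_integral_add 1 2)
  \<comment> \<open>At \<open>x = 0\<close> both indicators vanish while the density is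
    \<open>p * (1 - p)\<close>, so the equality holds only off a null set.\<close>
  have ae: "AE x in lborel. of_real (p * (1 - p)) * (?f ?c x + ?f ?d (0 + (-1) * x)) =
               asymmetric_laplace_density p x *\<^sub>R iexp (t * x)"
    using AE_lborel_singleton[of 0]
  proof eventually_elim
    case (elim x)
    then show ?case
      by (auto simp: asymmetric_laplace_density_def scaleR_conv_of_real exp_of_real[symmetric]
          exp_add[symmetric] algebra_simps split: split_indicator)
  qed
  have "1 / ?c + 1 / ?d = 1 / (?c * ?d)"
    using nz by (simp add: field_simps) 
  then have val: "of_real (p * (1 - p)) * (1 / ?c + (1 / ?d) /\<^sub>R \<bar>-1\<bar>) = of_real (p * (1 - p)) / (?c * ?d)"
    by simp
  show ?thesis
    using 3 ae unfolding val
    by (subst has_bochner_integral_cong_AE[symmetric]) (auto)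
qed

text \<open>The total mass is the Fourier integral at \<open>t = 0\<close>.\<close>

lemma asymmetric_laplace_prob_space:
  assumes p: "0 < p" "p < 1"
  shows "prob_space (density lborel (asymmetric_laplace_density p))"
proof
  have "has_bochner_integral lborel (\<lambda>x. complex_of_real (asymmetric_laplace_density p x)) 1"
    using asymmetric_laplace_fourier[OF p, of 0] p by (simp add: scaleR_conv_of_real)
  then have "integrable lborel (asymmetric_laplace_density p)"
            "integral\<^sup>L lborel (asymmetric_laplace_density p) = 1"
    by (auto simp: has_bochner_integral_iff complex_of_real_integrable_eq)
  then show "emeasure (density lborel (asymmetric_laplace_density p))
               (space (density lborel (asymmetric_laplace_density p))) = 1"
    using p by (simp add: emeasure_density nn_integral_eq_integral asymmetric_laplace_density_nonneg)
qed

lemma char_asymmetric_laplace: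
  assumes p: "0 < p" "p < 1"
  shows "char (density lborel (asymmetric_laplace_density p)) t =
           of_real (p * (1 - p)) / ((of_real p - \<i> * of_real t) * (of_real (1 - p) + \<i> * of_real t))"
  using asymmetric_laplace_fourier[OF p, of t] p
  by (simp add: char_def integral_density asymmetric_laplace_density_nonneg has_bochner_integral_iff)

section \<open>Convolution with the half-normal law, and the location-scale form of the
  density\<close>

lemma nn_integral_shifted_std_normal_Ioc:
  fixes a b m :: real
  assumes "a \<le> b"
  shows "(\<integral>\<^sup>+s. ennreal (std_normal_density (s - m)) * indicator {a<..b} s \<partial>lborel) =
           ennreal (std_normal_cdf (b - m) - std_normal_cdf (a - m))"
proof -
  interpret real_distribution std_normal_distribution
    by (rule real_dist_normal_dist)
  have "(\<integral>\<^sup>+s. ennreal (std_normal_density (s - m)) * indicator {a<..b} s \<partial>lborel) =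
        (\<integral>\<^sup>+s. ennreal (std_normal_density s) * indicator {a - m<..b - m} s \<partial>lborel)"
    by (subst nn_integral_real_affine[of _ 1 m])
       (auto intro!: nn_integral_cong split: split_indicator)
  also have "\<dots> = emeasure std_normal_distribution {a - m<..b - m}"
    by (simp add: emeasure_density)
  also have "\<dots> = ennreal (std_normal_cdf (b - m) - std_normal_cdf (a - m))"
    unfolding std_normal_cdf_def using assms by (intro emeasure_Ioc) simp
  finally show ?thesis .
qed

text \<open>The reflection of \<open>s\<close> to \<open>m - s\<close> turns the upper tail into a
  lower one, by symmetry of the normal density.\<close>

lemma nn_integral_shifted_std_normal_Ioi:
  fixes a m :: real
  shows "(\<integral>\<^sup>+s. ennreal (std_normal_density (s - m)) * indicator {a<..} s \<partial>lborel) =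
           ennreal (std_normal_cdf (m - a))"
proof -
  interpret real_distribution std_normal_distribution
    by (rule real_dist_normal_dist)
  have "(\<integral>\<^sup>+s. ennreal (std_normal_density (s - m)) * indicator {a<..} s \<partial>lborel) =
        (\<integral>\<^sup>+s. ennreal (std_normal_density s) * indicator {..<m - a} s \<partial>lborel)"
    by (subst nn_integral_real_affine[of _ "-1" m])
       (auto intro!: nn_integral_cong simp: normal_density_def split: split_indicator)
  \<comment> \<open>The reflected ray is open, whereas the cdf measures the closed one; the endpoint
    is null.\<close>
  also have "\<dots> = (\<integral>\<^sup>+s. ennreal (std_normal_density s) * indicator {..m - a} s \<partial>lborel)"
    using AE_lborel_singleton[of "m - a"]
    by (intro nn_integral_cong_AE) (auto split: split_indicator elim!: eventually_mono)
  also have "\<dots> = emeasure std_normal_distribution {..m - a}"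
    by (simp add: emeasure_density)
  also have "\<dots> = ennreal (std_normal_cdf (m - a))"
    by (simp add: std_normal_cdf_def cdf_def emeasure_eq_measure)
  finally show ?thesis .
qed

lemma half_normal_density_eq:
  "half_normal_density s = (if s > 0 then 2 * std_normal_density s else 0)"
  by (simp add: half_normal_density_def normal_density_def)

lemma borel_measurable_half_normal_density [measurable]: "half_normal_density \<in> borel_measurable borel"
  unfolding half_normal_density_eq by measurable

lemma half_normal_density_nonneg: "0 \<le> half_normal_density s"
  by (simp add: half_normal_density_def)

text \<open>For \<open>s\<close> below \<open>x / \<alpha>\<close> the argument
  \<open>x - \<alpha> * s\<close> has the sign of \<open>\<alpha>\<close>, so the slope is
  \<open>p_alpha_minus\<close>; above it the sign flips and the slope is
  \<open>p_alpha_plus\<close>. With slope \<open>c\<close>, completing the square in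
  \<open>s\<close> leaves a normal density with mean \<open>\<alpha> * c\<close>.\<close>

lemma asymmetric_laplace_convolution_half_normal:
  assumes p: "0 < p" "p < 1" and "\<alpha> \<noteq> 0"
  shows "(\<integral>\<^sup>+s. ennreal (asymmetric_laplace_density p (x - \<alpha> * s)) * ennreal (half_normal_density s) \<partial>lborel)
           = ennreal (gal_density 0 1 p \<alpha> x)"
proof -
  \<comment> \<open>The breakpoint is truncated at 0 because the half-normal law lives on
    \<open>s > 0\<close>. This truncation produces both indicators of
    \<open>gal_density\<close>.\<close>
  define z where "z = max 0 (x / \<alpha>)"
  define q where "q = p_alpha_minus p \<alpha>"
  define r where "r = p_alpha_plus p \<alpha>"
  \<comment> \<open>\<open>K c\<close> is what does not depend on \<open>s\<close> after the square
    is completed; its factor 2 comes from the half-normal density.\<close>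
  define K where "K c = 2 * p * (1 - p) * exp (- x * c + (\<alpha> * c)\<^sup>2 / 2)" for c
  interpret real_distribution std_normal_distribution
    by (rule real_dist_normal_dist)
  have K_nonneg: "0 \<le> K c" for c
    using p by (simp add: K_def)
  have z: "0 \<le> z" "s \<le> z \<longleftrightarrow> s \<le> x / \<alpha>" if "0 < s" for s
    using that by (auto simp: z_def)
  have square: "p * (1 - p) * exp (- (x - \<alpha> * s) * c) * half_normal_density s =
      K c * std_normal_density (s - \<alpha> * c)" if "0 < s" for s c
  proof -
    have "- (x - \<alpha> * s) * c + (- s\<^sup>2 / 2) = (- x * c + (\<alpha> * c)\<^sup>2 / 2) + (- (s - \<alpha> * c)\<^sup>2 / 2)"
      by (simp add: power2_eq_square field_simps)
    then have "exp (- (x - \<alpha> * s) * c) * exp (- s\<^sup>2 / 2) =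
        exp (- x * c + (\<alpha> * c)\<^sup>2 / 2) * exp (- (s - \<alpha> * c)\<^sup>2 / 2)"
      by (simp only: exp_add[symmetric])
    then show ?thesis
      using that by (simp add: half_normal_density_def K_def normal_density_def)
  qed
  \<comment> \<open>The endpoint \<open>s = x / \<alpha>\<close> may be included: there the exponent
    is 0 for either slope.\<close>
  have lower: "asymmetric_laplace_density p (x - \<alpha> * s) = p * (1 - p) * exp (- (x - \<alpha> * s) * q)"
    if "s \<le> x / \<alpha>" for s
    using that \<open>\<alpha> \<noteq> 0\<close>
    by (cases "x = \<alpha> * s"; cases "\<alpha> > 0")
       (auto simp: asymmetric_laplace_density_def q_def p_alpha_minus_def field_simps of_bool_def)
  have upper: "asymmetric_laplace_density p (x - \<alpha> * s) = p * (1 - p) * exp (- (x - \<alpha> * s) * r)"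
    if "\<not> s \<le> x / \<alpha>" for s
    using that \<open>\<alpha> \<noteq> 0\<close>
    by (cases "\<alpha> > 0")
       (auto simp: asymmetric_laplace_density_def r_def p_alpha_plus_def field_simps of_bool_def)
  have "(\<integral>\<^sup>+s. ennreal (asymmetric_laplace_density p (x - \<alpha> * s)) * ennreal (half_normal_density s) \<partial>lborel)
      = (\<integral>\<^sup>+s. ennreal (K q) * (ennreal (std_normal_density (s - \<alpha> * q)) * indicator {0<..z} s)
           + ennreal (K r) * (ennreal (std_normal_density (s - \<alpha> * r)) * indicator {z<..} s) \<partial>lborel)"
  proof (rule nn_integral_cong)
    fix s :: real
    have "ennreal (asymmetric_laplace_density p (x - \<alpha> * s)) * ennreal (half_normal_density s) =
        ennreal (asymmetric_laplace_density p (x - \<alpha> * s) * half_normal_density s)"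
      by (simp add: ennreal_mult'' half_normal_density_nonneg)
    also have "\<dots> = ennreal (K q) * (ennreal (std_normal_density (s - \<alpha> * q)) * indicator {0<..z} s)
           + ennreal (K r) * (ennreal (std_normal_density (s - \<alpha> * r)) * indicator {z<..} s)"
    proof (cases "0 < s")
      case True
      then show ?thesis
        using z[OF True] lower[of s] upper[of s] square[OF True, of q] square[OF True, of r] K_nonneg
        by (cases "s \<le> x / \<alpha>") (auto simp: ennreal_mult'' split: split_indicator)
    next
      case False
      then show ?thesis
        using le_max_iff_disj[of s 0 "x / \<alpha>"]
        by (auto simp: half_normal_density_def z_def split: split_indicator)
    qed
    finally show "ennreal (asymmetric_laplace_density p (x - \<alpha> * s)) * ennreal (half_normal_density s) = \<dots>" .
  qed
  also have "\<dots> = ennreal (K q) * ennreal (std_normal_cdf (z - \<alpha> * q) - std_normal_cdf (- \<alpha> * q))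
      + ennreal (K r) * ennreal (std_normal_cdf (\<alpha> * r - z))"
    using nn_integral_shifted_std_normal_Ioc[of 0 z "\<alpha> * q"]
      nn_integral_shifted_std_normal_Ioi[of "\<alpha> * r" z]
    by (simp add: nn_integral_add nn_integral_cmult z_def)
  \<comment> \<open>Joining the terms inside \<open>ennreal\<close> uses that the difference of cdf
    values is nonnegative: the cdf is monotone and \<open>0 \<le> z\<close>.\<close>
  also have "\<dots> = ennreal (K q * (std_normal_cdf (z - \<alpha> * q) - std_normal_cdf (- \<alpha> * q))
      + K r * std_normal_cdf (\<alpha> * r - z))"
    using cdf_nondecreasing[of "- \<alpha> * q" "z - \<alpha> * q"] cdf_nonneg K_nonneg
    by (simp add: ennreal_mult ennreal_plus z_def std_normal_cdf_def)
  \<comment> \<open>If \<open>x / \<alpha>\<close> is not positive, then \<open>z = 0\<close> and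
    the first bracket cancels, matching the vanishing indicator.\<close>
  also have "K q * (std_normal_cdf (z - \<alpha> * q) - std_normal_cdf (- \<alpha> * q))
      + K r * std_normal_cdf (\<alpha> * r - z) = gal_density 0 1 p \<alpha> x"
    by (cases "0 < x / \<alpha>")
       (simp_all add: gal_density_def Let_def q_def r_def K_def z_def max_def algebra_simps)
  finally show ?thesis .
qed

text \<open>This reduces the computation to \<open>\<mu> = 0\<close> and
  \<open>\<sigma> = 1\<close>.\<close>

lemma gal_density_affine:
  "gal_density \<mu> \<sigma> p \<alpha> y = gal_density 0 1 p \<alpha> ((y - \<mu>) / \<sigma>) / \<sigma>"
  by (simp add: gal_density_def Let_def)

section \<open>The law of the mixture built from a latent triple\<close>

context
  fixes N :: "'b measure" and W S U :: "'b \<Rightarrow> real"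
  assumes latent: "gal_latent N W S U"
begin

interpretation N: prob_space N
  using latent by (simp add: gal_latent_def)

lemma latent_distributed:
  "distributed N lborel W (exponential_density 1)"
  "distributed N lborel S half_normal_density"
  "distributed N lborel U std_normal_density"
  using latent by (simp_all add: gal_latent_def)

lemma latent_measurable [measurable]:
  "W \<in> borel_measurable N" "S \<in> borel_measurable N" "U \<in> borel_measurable N"
  using latent_distributed[THEN distributed_measurable] by simp_all

text \<open>Functions of disjoint blocks of an independent family are independent; positions 0, 1, 2
  hold \<open>W\<close>, \<open>S\<close>, \<open>U\<close>. The second claim separates the Laplace
  part, a function of \<open>W\<close> and \<open>U\<close>, from \<open>S\<close>.\<close>

lemma latent_indep:
  shows "N.indep_var borel W borel U"
    and "f \<in> borel_measurable (borel \<Otimes>\<^sub>M borel) \<Longrightarrow> N.indep_var borel (\<lambda>\<omega>. f (W \<omega>, U \<omega>) :: real) borel S"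
proof -
  have ind: "N.indep_vars (\<lambda>_. borel) (\<lambda>i. [W, S, U] ! i) {..<3}"
    using latent by (simp add: gal_latent_def)
  have "N.indep_var borel ((\<lambda>g. g 0) \<circ> (\<lambda>\<omega>. restrict (\<lambda>i. ([W, S, U] ! i) \<omega>) {0}))
          borel ((\<lambda>g. g 2) \<circ> (\<lambda>\<omega>. restrict (\<lambda>i. ([W, S, U] ! i) \<omega>) {2}))"
    by (rule N.indep_var_compose[OF N.indep_var_restrict[OF ind]]) auto
  then show "N.indep_var borel W borel U"
    by (simp add: comp_def)
  assume f[measurable]: "f \<in> borel_measurable (borel \<Otimes>\<^sub>M borel)"
  have "N.indep_var borel ((\<lambda>g. f (g 0, g 2)) \<circ> (\<lambda>\<omega>. restrict (\<lambda>i. ([W, S, U] ! i) \<omega>) {0, 2}))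
          borel ((\<lambda>g. g 1) \<circ> (\<lambda>\<omega>. restrict (\<lambda>i. ([W, S, U] ! i) \<omega>) {1}))"
    by (rule N.indep_var_compose[OF N.indep_var_restrict[OF ind]]) auto
  then show "N.indep_var borel (\<lambda>\<omega>. f (W \<omega>, U \<omega>)) borel S"
    by (simp add: comp_def)
qed

text \<open>Given \<open>W = w\<close>, the variable is normal with mean \<open>a * w\<close> and
  variance \<open>b * w\<close>, so its characteristic function is an exponential in
  \<open>w\<close>; averaging over \<open>W\<close> adds 1 to the rate and integrates it.\<close>

lemma char_latent_normal_mixture:
  assumes "0 \<le> b"
  shows "char (distr N borel (\<lambda>\<omega>. a * W \<omega> + sqrt (b * W \<omega>) * U \<omega>)) t =
           1 / (1 - \<i> * of_real (t * a) + of_real (t\<^sup>2 * b / 2))"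
proof -
  interpret D: prob_space "density lborel (exponential_density 1)"
    by (rule prob_space_exponential_density) simp
  interpret G: real_distribution std_normal_distribution
    by (rule real_dist_normal_dist)
  interpret DG: pair_prob_space "density lborel (exponential_density 1)" std_normal_distribution ..
  let ?e = "\<lambda>w u. iexp (t * (a * w + sqrt (b * w) * u))"
  \<comment> \<open>The restriction \<open>0 \<le> w\<close> makes the square of
    \<open>sqrt (b * w)\<close> equal to \<open>b * w\<close>.\<close>
  have inner: "(CLINT u|std_normal_distribution. ?e w u) =
      exp (- (of_real (t\<^sup>2 * b / 2) - \<i> * of_real (t * a)) * of_real w)" if "0 \<le> w" for w
  proof -
    have "(CLINT u|std_normal_distribution. ?e w u) =
        (CLINT u|std_normal_distribution. iexp (t * a * w) * iexp ((t * sqrt (b * w)) * u))"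
      by (simp add: exp_add[symmetric] algebra_simps)
    also have "\<dots> = iexp (t * a * w) * char std_normal_distribution (t * sqrt (b * w))"
      by (simp add: char_def)
    also have "\<dots> = iexp (t * a * w) * exp (of_real (- (t\<^sup>2 * (b * w)) / 2))"
      using that assms
      by (simp add: char_std_normal_distribution power_mult_distrib, simp flip: exp_of_real)
    also have "\<dots> = exp (- (of_real (t\<^sup>2 * b / 2) - \<i> * of_real (t * a)) * of_real w)"
      by (simp add: exp_add[symmetric] algebra_simps flip: exp_of_real)
    finally show ?thesis .
  qed
  \<comment> \<open>Independence makes the joint law a product, which is what Fubini needs
    below.\<close>
  have joint: "distr N (borel \<Otimes>\<^sub>M borel) (\<lambda>\<omega>. (W \<omega>, U \<omega>)) =
      density lborel (exponential_density 1) \<Otimes>\<^sub>M std_normal_distribution"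
    using latent_indep(1) latent_distributed(1,3)[THEN distributed_distr_eq_density]
    by (simp add: N.indep_var_distribution_eq cong: distr_cong)
  have "char (distr N borel (\<lambda>\<omega>. a * W \<omega> + sqrt (b * W \<omega>) * U \<omega>)) t =
      (CLINT \<omega>|N. ?e (W \<omega>) (U \<omega>))"
    by (simp add: char_def integral_distr)
  also have "\<dots> = (CLINT x|distr N (borel \<Otimes>\<^sub>M borel) (\<lambda>\<omega>. (W \<omega>, U \<omega>)). ?e (fst x) (snd x))"
    by (simp add: integral_distr)
  also have "\<dots> = (CLINT x|density lborel (exponential_density 1) \<Otimes>\<^sub>M std_normal_distribution. case x of (w, u) \<Rightarrow> ?e w u)"
    by (simp add: joint case_prod_beta)
  also have "\<dots> = (CLINT w|density lborel (exponential_density 1). CLINT u|std_normal_distribution. ?e w u)"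
    by (rule DG.integral_fst[symmetric], rule DG.P.integrable_const_bound[where B=1]) auto
  also have "\<dots> = (CLINT w|lborel. exponential_density 1 w *\<^sub>R (CLINT u|std_normal_distribution. ?e w u))"
    by (subst integral_density) (auto simp: exponential_density_nonneg)
  \<comment> \<open>Both sides vanish for \<open>w < 0\<close>; at 0 the exponential density is 1
    but the indicator is 0, hence equality almost everywhere.\<close>
  also have "\<dots> = (CLINT w|lborel. indicator {0<..} w *\<^sub>R
      exp (- (1 - \<i> * of_real (t * a) + of_real (t\<^sup>2 * b / 2)) * of_real w))"
  proof (rule integral_cong_AE)
    show "AE w in lborel. exponential_density 1 w *\<^sub>R (CLINT u|std_normal_distribution. ?e w u) =
        indicator {0<..} w *\<^sub>R exp (- (1 - \<i> * of_real (t * a) + of_real (t\<^sup>2 * b / 2)) * of_real w)"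
      using AE_lborel_singleton[of 0]
    proof eventually_elim
      case (elim w)
      show ?case
      proof (cases "0 < w")
        case True
        then have "exponential_density 1 w *\<^sub>R (CLINT u|std_normal_distribution. ?e w u) =
            exp (of_real (- w)) * exp (- (of_real (t\<^sup>2 * b / 2) - \<i> * of_real (t * a)) * of_real w)"
          unfolding inner[OF less_imp_le[OF True]] exp_of_real
          by (simp add: exponential_density_def scaleR_conv_of_real)
        then show ?thesis
          using True unfolding exp_add[symmetric] by (simp add: algebra_simps)
      next
        case False
        with elim show ?thesis
          by (simp add: exponential_density_def)
      qed
    qed
  qed measurable
  \<comment> \<open>The rate has real part \<open>1 + t\<^sup>2 * b / 2\<close>, which is
    positive.\<close>
  also have "\<dots> = 1 / (1 - \<i> * of_real (t * a) + of_real (t\<^sup>2 * b / 2))"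
    using assms by (intro has_bochner_integral_integral_eq has_bochner_integral_exp_Ioi)
      (simp add: add_pos_nonneg)
  finally show ?thesis .
qed

lemma latent_asymmetric_laplace:
  assumes p: "0 < p" "p < 1"
  shows "distributed N lborel (\<lambda>\<omega>. gal_A p * W \<omega> + sqrt (gal_B p * W \<omega>) * U \<omega>) (asymmetric_laplace_density p)"
proof -
  interpret L: prob_space "density lborel (asymmetric_laplace_density p)"
    using p by (rule asymmetric_laplace_prob_space)
  let ?E = "\<lambda>\<omega>. gal_A p * W \<omega> + sqrt (gal_B p * W \<omega>) * U \<omega>"
  have "distr N borel ?E = density lborel (asymmetric_laplace_density p)"
  proof (rule Levy_uniqueness)
    show "real_distribution (distr N borel ?E)"
      by (rule N.real_distribution_distr) measurable
    show "real_distribution (density lborel (asymmetric_laplace_density p))"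
      by unfold_locales simp_all
    show "char (distr N borel ?E) = char (density lborel (asymmetric_laplace_density p))"
    proof
      fix t :: real
      have B: "0 \<le> gal_B p"
        using p by (simp add: gal_B_def)
      \<comment> \<open>Over the common denominator \<open>D\<close> the numerator factors into the
        two rates of the Laplace law; this is where the particular \<open>gal_A\<close> and
        \<open>gal_B\<close> matter.\<close>
      define D :: complex where "D = of_real (p * (1 - p))"
      have "D \<noteq> 0"
        using p by (simp add: D_def)
      have "gal_A p = (1 - 2 * p) / (p * (1 - p))" "gal_B p / 2 = 1 / (p * (1 - p))"
        by (simp_all add: gal_A_def gal_B_def)
      then have "1 - \<i> * of_real (t * gal_A p) + of_real (t\<^sup>2 * gal_B p / 2) =
          1 - \<i> * (of_real (t * (1 - 2 * p)) / D) + of_real (t\<^sup>2) / D"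
        unfolding D_def times_divide_eq_right[symmetric] of_real_mult of_real_divide by simp
      also have "\<dots> = (D - \<i> * of_real (t * (1 - 2 * p)) + of_real (t\<^sup>2)) / D"
        using \<open>D \<noteq> 0\<close> by (simp add: add_divide_distrib diff_divide_distrib)
      also have "D - \<i> * of_real (t * (1 - 2 * p)) + of_real (t\<^sup>2) =
          (of_real p - \<i> * of_real t) * (of_real (1 - p) + \<i> * of_real t)"
        by (simp add: D_def complex_eq_iff power2_eq_square algebra_simps)
      finally have denom: "1 - \<i> * of_real (t * gal_A p) + of_real (t\<^sup>2 * gal_B p / 2) =
          (of_real p - \<i> * of_real t) * (of_real (1 - p) + \<i> * of_real t) / of_real (p * (1 - p))"
        unfolding D_def .
      show "char (distr N borel ?E) t = char (density lborel (asymmetric_laplace_density p)) t"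
        by (simp only: char_latent_normal_mixture[OF B] char_asymmetric_laplace[OF p] denom
            divide_divide_eq_right mult_1_left)
    qed
  qed
  then show ?thesis
    using p by (simp add: distributed_def cong: distr_cong)
qed

lemma distributed_gal_mixture:
  assumes "0 < \<sigma>" and p: "0 < p" "p < 1" and "\<alpha> \<noteq> 0"
  shows "distributed N lborel (gal_mixture \<mu> \<sigma> p \<alpha> W S U) (gal_density \<mu> \<sigma> p \<alpha>)"
proof -
  let ?E = "\<lambda>\<omega>. gal_A p * W \<omega> + sqrt (gal_B p * W \<omega>) * U \<omega>"
  have "N.indep_var borel (\<lambda>\<omega>. (\<lambda>(w, u). gal_A p * w + sqrt (gal_B p * w) * u) (W \<omega>, U \<omega>)) borel S"
    by (rule latent_indep) measurable
  \<comment> \<open>The form \<open>0 + \<alpha> * s\<close> matches the affine rule that supplies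
    the density of \<open>\<alpha> * S\<close>.\<close>
  then have "N.indep_var borel (id \<circ> ?E) borel ((\<lambda>s. 0 + \<alpha> * s) \<circ> S)"
    by (intro N.indep_var_compose[of borel _ borel]) auto
  then have "N.indep_var borel ?E borel (\<lambda>\<omega>. 0 + \<alpha> * S \<omega>)"
    by (simp add: comp_def)
  then have "distributed N lborel (\<lambda>\<omega>. ?E \<omega> + (0 + \<alpha> * S \<omega>))
      (\<lambda>x. \<integral>\<^sup>+y. ennreal (asymmetric_laplace_density p (x - y)) *
         (ennreal (half_normal_density ((y - 0) / \<alpha>)) / ennreal \<bar>\<alpha>\<bar>) \<partial>lborel)"
    using latent_asymmetric_laplace[OF p] N.distributed_affine[OF latent_distributed(2) \<open>\<alpha> \<noteq> 0\<close>, of 0]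
    by (rule N.distributed_convolution)
  also have "(\<lambda>x. \<integral>\<^sup>+y. ennreal (asymmetric_laplace_density p (x - y)) *
         (ennreal (half_normal_density ((y - 0) / \<alpha>)) / ennreal \<bar>\<alpha>\<bar>) \<partial>lborel) =
      (\<lambda>x. ennreal (gal_density 0 1 p \<alpha> x))"
  proof
    fix x
    \<comment> \<open>Substituting \<open>y = \<alpha> * s\<close> gives a Jacobian that cancels the
      \<open>1 / \<bar>\<alpha>\<bar>\<close> in the density of \<open>\<alpha> * S\<close>.\<close>
    have "(\<integral>\<^sup>+y. ennreal (asymmetric_laplace_density p (x - y)) *
         (ennreal (half_normal_density ((y - 0) / \<alpha>)) / ennreal \<bar>\<alpha>\<bar>) \<partial>lborel) =
       \<bar>\<alpha>\<bar> * (\<integral>\<^sup>+s. ennreal (asymmetric_laplace_density p (x - \<alpha> * s)) *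
         (ennreal (half_normal_density s) / ennreal \<bar>\<alpha>\<bar>) \<partial>lborel)"
      using \<open>\<alpha> \<noteq> 0\<close> by (subst nn_integral_real_affine[of _ \<alpha> 0]) simp_all
    also have "\<dots> = (\<integral>\<^sup>+s. \<bar>\<alpha>\<bar> * (ennreal (asymmetric_laplace_density p (x - \<alpha> * s)) *
         (ennreal (half_normal_density s) / ennreal \<bar>\<alpha>\<bar>)) \<partial>lborel)"
      by (subst nn_integral_cmult) simp_all
    also have "\<dots> = (\<integral>\<^sup>+s. ennreal (asymmetric_laplace_density p (x - \<alpha> * s)) *
         ennreal (half_normal_density s) \<partial>lborel)"
      using \<open>\<alpha> \<noteq> 0\<close> p
      by (intro nn_integral_cong)
         (simp add: divide_ennreal ennreal_mult'[symmetric] half_normal_density_nonneg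
           asymmetric_laplace_density_nonneg)
    also have "\<dots> = ennreal (gal_density 0 1 p \<alpha> x)"
      using p \<open>\<alpha> \<noteq> 0\<close> by (rule asymmetric_laplace_convolution_half_normal)
    finally show "(\<integral>\<^sup>+y. ennreal (asymmetric_laplace_density p (x - y)) *
         (ennreal (half_normal_density ((y - 0) / \<alpha>)) / ennreal \<bar>\<alpha>\<bar>) \<partial>lborel) = \<dots>" .
  qed
  finally have "distributed N lborel (\<lambda>\<omega>. ?E \<omega> + (0 + \<alpha> * S \<omega>)) (\<lambda>x. ennreal (gal_density 0 1 p \<alpha> x))" .
  from N.distributed_affine[OF this, of \<sigma> \<mu>] \<open>0 < \<sigma>\<close>
  have "distributed N lborel (\<lambda>\<omega>. \<mu> + \<sigma> * (?E \<omega> + (0 + \<alpha> * S \<omega>)))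
      (\<lambda>y. ennreal (gal_density 0 1 p \<alpha> ((y - \<mu>) / \<sigma>)) / ennreal \<sigma>)"
    by simp
  also have "(\<lambda>y. ennreal (gal_density 0 1 p \<alpha> ((y - \<mu>) / \<sigma>)) / ennreal \<sigma>) =
      (\<lambda>y. ennreal (gal_density \<mu> \<sigma> p \<alpha> y))"
  proof
    fix y
    \<comment> \<open>The case split is on the sign of the density value: \<open>ennreal\<close>
      sends negative reals to 0, so both sides agree there too.\<close>
    show "ennreal (gal_density 0 1 p \<alpha> ((y - \<mu>) / \<sigma>)) / ennreal \<sigma> = ennreal (gal_density \<mu> \<sigma> p \<alpha> y)"
      using \<open>0 < \<sigma>\<close> unfolding gal_density_affine[of \<mu> \<sigma>]
      by (cases "0 \<le> gal_density 0 1 p \<alpha> ((y - \<mu>) / \<sigma>)")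
         (auto simp: divide_ennreal ennreal_neg divide_nonpos_pos)
  qed
  also have "(\<lambda>\<omega>. \<mu> + \<sigma> * (?E \<omega> + (0 + \<alpha> * S \<omega>))) = gal_mixture \<mu> \<sigma> p \<alpha> W S U"
    by (simp add: fun_eq_iff gal_mixture_def algebra_simps)
  finally show ?thesis .
qed

end

section \<open>Existence of a latent triple\<close>

lemma prob_space_half_normal: "prob_space (density lborel half_normal_density)"
proof
  interpret real_distribution std_normal_distribution
    by (rule real_dist_normal_dist)
  \<comment> \<open>Symmetry equates the cdf at 0 with the upper tail, which is also its complement;
    hence the value 1/2.\<close>
  have "ennreal (std_normal_cdf 0) = emeasure std_normal_distribution {0<..}"
    using nn_integral_shifted_std_normal_Ioi[of 0 0] by (simp add: emeasure_density)
  then have "std_normal_cdf 0 = prob {0<..}"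
    by (simp add: emeasure_eq_measure std_normal_cdf_def cdf_nonneg)
  also have "{0::real<..} = space std_normal_distribution - {..0}"
    by auto
  also have "prob \<dots> = 1 - std_normal_cdf 0"
    unfolding std_normal_cdf_def cdf_def by (rule prob_compl) simp
  finally have median: "std_normal_cdf 0 = 1 / 2"
    by simp
  have "(\<integral>\<^sup>+s. ennreal (half_normal_density s) \<partial>lborel) =
      (\<integral>\<^sup>+s. 2 * (ennreal (std_normal_density (s - 0)) * indicator {0<..} s) \<partial>lborel)"
    by (intro nn_integral_cong) (auto simp: half_normal_density_eq ennreal_mult split: split_indicator)
  also have "\<dots> = 2 * ennreal (std_normal_cdf 0)"
    using nn_integral_shifted_std_normal_Ioi[of 0 0] by (simp add: nn_integral_cmult)
  also have "\<dots> = 1"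
    using ennreal_mult'[of 2 "1 / 2"] by (simp add: median)
  finally show "emeasure (density lborel half_normal_density) (space (density lborel half_normal_density)) = 1"
    by (simp add: emeasure_density)
qed

text \<open>The witness is the product of the three laws with its coordinate projections.\<close>

lemma gal_latent_exists:
  "\<exists>(N :: (real \<times> real \<times> real) measure) W S U. gal_latent N W S U"
proof -
  let ?DW = "density lborel (exponential_density 1)" and ?DS = "density lborel half_normal_density"
    and ?DU = "std_normal_distribution"
  interpret DW: prob_space ?DW
    by (rule prob_space_exponential_density) simp
  interpret DS: prob_space ?DS
    by (rule prob_space_half_normal)
  interpret DU: prob_space ?DU
    by (rule prob_space_normal_density) simp
  interpret SU: pair_prob_space ?DS ?DU ..
  interpret WSU: pair_prob_space ?DW "?DS \<Otimes>\<^sub>M ?DU" ..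
  let ?N = "?DW \<Otimes>\<^sub>M (?DS \<Otimes>\<^sub>M ?DU)"
  let ?W = "\<lambda>\<omega> :: real \<times> real \<times> real. fst \<omega>"
    and ?S = "\<lambda>\<omega> :: real \<times> real \<times> real. fst (snd \<omega>)"
    and ?U = "\<lambda>\<omega> :: real \<times> real \<times> real. snd (snd \<omega>)"
  have space_N: "space ?N = UNIV"
    by (simp add: space_pair_measure)
  have box: "emeasure ?N (A \<times> B \<times> C) = emeasure ?DW A * emeasure ?DS B * emeasure ?DU C"
    if "A \<in> sets borel" "B \<in> sets borel" "C \<in> sets borel" for A B C
    using that by (simp add: DU.emeasure_pair_measure_Times SU.emeasure_pair_measure_Times mult.assoc)
  have one: "emeasure ?DW UNIV = 1" "emeasure ?DS UNIV = 1" "emeasure ?DU UNIV = 1"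
    using DW.emeasure_space_1 DS.emeasure_space_1 DU.emeasure_space_1 by simp_all
  \<comment> \<open>A preimage under a projection is a box whose other two sides are full and have
    mass 1.\<close>
  have pre: "emeasure ?N (?W -` A) = emeasure ?DW A" "emeasure ?N (?S -` A) = emeasure ?DS A"
    "emeasure ?N (?U -` A) = emeasure ?DU A" if "A \<in> sets borel" for A
  proof -
    have "?W -` A = A \<times> UNIV \<times> UNIV" "?S -` A = UNIV \<times> A \<times> UNIV" "?U -` A = UNIV \<times> UNIV \<times> A"
      by auto
    then show "emeasure ?N (?W -` A) = emeasure ?DW A" "emeasure ?N (?S -` A) = emeasure ?DS A"
      "emeasure ?N (?U -` A) = emeasure ?DU A"
      using that by (simp_all add: box one del: UNIV_Times_UNIV)
  qed
  have meas: "?W \<in> borel_measurable ?N" "?S \<in> borel_measurable ?N" "?U \<in> borel_measurable ?N"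
    by measurable
  have "distr ?N lborel ?W = ?DW" "distr ?N lborel ?S = ?DS" "distr ?N lborel ?U = ?DU"
    by (rule measure_eqI; use meas in \<open>simp add: emeasure_distr space_N pre\<close>)+
  then have dists: "distributed ?N lborel ?W (exponential_density 1)"
    "distributed ?N lborel ?S half_normal_density" "distributed ?N lborel ?U std_normal_density"
    using meas by (simp_all add: distributed_def)
  have lt3: "{..<3::nat} = {0, 1, 2}"
    by auto
  \<comment> \<open>The generator is the whole Borel sigma-algebra, closed under intersection. The
    intersection of the three preimages is a box, so the product formula is \<open>box\<close>
    together with \<open>pre\<close>.\<close>
  have "WSU.indep_vars (\<lambda>_. borel) (\<lambda>i. [?W, ?S, ?U] ! i) {..<3}"
  proof (subst WSU.indep_vars_finite[where E="\<lambda>_. sets borel"])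
    show "\<forall>A\<in>{..<3} \<rightarrow> sets borel.
        WSU.prob (\<Inter>j\<in>{..<3}. ([?W, ?S, ?U] ! j) -` A j \<inter> space ?N) =
        (\<Prod>j\<in>{..<3}. WSU.prob (([?W, ?S, ?U] ! j) -` A j \<inter> space ?N))"
    proof
      fix A :: "nat \<Rightarrow> real set"
      assume "A \<in> {..<3} \<rightarrow> sets borel"
      then have A: "A 0 \<in> sets borel" "A 1 \<in> sets borel" "A 2 \<in> sets borel"
        by auto
      have "(\<Inter>j\<in>{..<3}. ([?W, ?S, ?U] ! j) -` A j \<inter> space ?N) = A 0 \<times> A 1 \<times> A 2"
        unfolding lt3 space_N by auto
      then show "WSU.prob (\<Inter>j\<in>{..<3}. ([?W, ?S, ?U] ! j) -` A j \<inter> space ?N) =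
        (\<Prod>j\<in>{..<3}. WSU.prob (([?W, ?S, ?U] ! j) -` A j \<inter> space ?N))"
        by (simp add: lt3 space_N measure_def box pre A A(2)[unfolded One_nat_def] enn2real_mult mult.assoc)
    qed
    show "([?W, ?S, ?U] ! i) \<in> borel_measurable ?N" if "i \<in> {..<3}" for i
      using that meas unfolding lt3 by auto
  qed (auto simp: lt3 Int_stable_def sets.sigma_sets_eq[of borel, simplified])
  then have "gal_latent ?N ?W ?S ?U"
    using dists by (simp add: gal_latent_def WSU.prob_space_axioms)
  then show ?thesis
    by blast
qed

text \<open>Equality in law is claimed for every latent triple on a space of arbitrary type
  \<open>'b\<close>; the existential conjunct, on a concrete type, ensures that a representation
  really exists.\<close>

theorem theorem1:
  fixes M :: "'a measure" and Y :: "'a \<Rightarrow> real" and \<mu> \<sigma> p \<alpha> :: real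
  assumes "\<sigma> > 0" and "0 < p" and "p < 1" and "\<alpha> \<noteq> 0"
    and "prob_space M"
    and "distributed M lborel Y (gal_density \<mu> \<sigma> p \<alpha>)"
  shows "(\<exists>(N :: (real \<times> real \<times> real) measure) W S U.
            gal_latent N W S U \<and>
            distr M borel Y = distr N borel (gal_mixture \<mu> \<sigma> p \<alpha> W S U)) \<and>
         (\<forall>(N :: 'b measure) W S U.
            gal_latent N W S U \<longrightarrow>
            distr M borel Y = distr N borel (gal_mixture \<mu> \<sigma> p \<alpha> W S U))"
proof -
  note mixture = distributed_gal_mixture[OF _ assms(1-4), THEN distributed_distr_eq_density]
  have "distr M lborel Y = density lborel (gal_density \<mu> \<sigma> p \<alpha>)"
    using assms(6) by (rule distributed_distr_eq_density)
  then have Y: "distr M borel Y = density lborel (gal_density \<mu> \<sigma> p \<alpha>)"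
    by (simp cong: distr_cong)
  \<comment> \<open>The same argument is run once for each of the two types of
    \<open>N\<close>.\<close>
  have "distr M borel Y = distr N borel (gal_mixture \<mu> \<sigma> p \<alpha> W S U)"
    if "gal_latent N W S U" for N :: "(real \<times> real \<times> real) measure" and W S U
    using mixture[OF that] by (simp add: Y cong: distr_cong)
  moreover have "distr M borel Y = distr N borel (gal_mixture \<mu> \<sigma> p \<alpha> W S U)"
    if "gal_latent N W S U" for N :: "'b measure" and W S U
    using mixture[OF that] by (simp add: Y cong: distr_cong)
  ultimately show ?thesis
    using gal_latent_exists by blast
qed

end
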